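(* Let $P_{(4,0)}$ be the set of all cylindric partitions with profile $c=(4,0)$. Then, as formal power series in $q$, $$\sum_{\Lambda\in P_{(4,0)}} q^{|\Lambda|}=\left(\sum_{n\ge0}\frac{q^{n(n+1)}(-q^2;q^2)_n}{(-q^3;q^2)_n\,(q^2;q^2)_n}\right)\frac{(-q^3;q^2)_\infty}{(q;q)_\infty}.$$
   Context: Let $r,\ell$ be positive integers and $c=(c_1,\dots,c_r)$ a composition of $\ell$ into $r$ nonnegative integer parts (zero entries allowed). A cylindric partition with profile $c$ is a tuple $\Lambda=(\lambda^{(1)},\dots,\lambda^{(r)})$ of ordinary partitions $\lambda^{(i)}=(\lambda^{(i)}_1\ge\lambda^{(i)}_2\ge\cdots)$ (parts beyond the length are taken to be $0$) such that for all $i,j$: $\lambda^{(i)}_j\ge\lambda^{(i+1)}_{j+c_{i+1}}$ for $1\le i\le r-1$, and $\lambda^{(r)}_j\ge\lambda^{(1)}_{j+c_1}$. The size $|\Lambda|$ is the sum of all parts of all $\lambda^{(i)}$; the empty cylindric partition is included with size $0$. Notation: $(a;q)_n=\prod_{k=1}^n(1-aq^{k-1})$, $(a;q)_\infty=\lim_{n\to\infty}(a;q)_n$. *)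

theory Defs
  imports
    "HOL-Analysis.Infinite_Sum"
    "HOL-Computational_Algebra.Formal_Power_Series"
begin

text \<open>
  A partition is the weakly decreasing, eventually zero sequence of its parts, indexed from 0:
  \<open>f j\<close> is the part usually written with index \<open>j + 1\<close>.
\<close>

definition is_partition :: "(nat \<Rightarrow> nat) \<Rightarrow> bool" where
  "is_partition f \<longleftrightarrow> antimono f \<and> finite {j. f j \<noteq> 0}"

definition partition_size :: "(nat \<Rightarrow> nat) \<Rightarrow> nat" where
  "partition_size f = (\<Sum>j | f j \<noteq> 0. f j)"

text \<open>
  The rank is the length of the profile \<open>c\<close>, assumed positive. Lists are indexed from 0, so
  \<open>c ! i\<close> and \<open>\<Lambda> ! i\<close> are the entries usually written with index \<open>i + 1\<close>.
\<close>

definition cylindric_partitions :: "nat list \<Rightarrow> (nat \<Rightarrow> nat) list set" where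
  "cylindric_partitions c = {\<Lambda>. length \<Lambda> = length c
     \<and> (\<forall>i < length c. is_partition (\<Lambda> ! i))
     \<and> (\<forall>i j. i + 1 < length c \<longrightarrow> (\<Lambda> ! i) j \<ge> (\<Lambda> ! (i + 1)) (j + c ! (i + 1)))
     \<and> (\<forall>j. (\<Lambda> ! (length c - 1)) j \<ge> (\<Lambda> ! 0) (j + c ! 0))}"

definition cylindric_size :: "(nat \<Rightarrow> nat) list \<Rightarrow> nat" where
  "cylindric_size \<Lambda> = (\<Sum>i < length \<Lambda>. partition_size (\<Lambda> ! i))"

definition qpoch :: "'a::comm_ring_1 \<Rightarrow> 'a \<Rightarrow> nat \<Rightarrow> 'a" where
  "qpoch a q n = (\<Prod>k=1..n. 1 - a * q ^ (k - 1))"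

text \<open>
  On formal power series, limits and infinite sums refer to the library's metric on
  type \<open>fps\<close>, that is, to the adic topology of the ideal generated by \<open>fps_X\<close>.
\<close>

definition qpoch_inf :: "'a::{comm_ring_1,t2_space} \<Rightarrow> 'a \<Rightarrow> 'a" where
  "qpoch_inf a q = lim (\<lambda>n. qpoch a q n)"

end

theory Submission
  imports Defs
begin

text \<open>
  Let \<open>T\<^sub>N(a, b)\<close> count the cylindric partitions with all parts at most \<open>N\<close> whose first \<open>a\<close>
  (respectively \<open>b\<close>) parts equal \<open>N\<close>. Removing a leading pair of parts equal to \<open>N\<close>, or subtracting
  1 from all parts equal to \<open>N\<close>, gives a linear recurrence that determines \<open>T\<^sub>N(0, 0)\<close>. Its solution is
  the coefficient of \<open>z\<^sup>N\<close> in \<open>H(z) \<Sum>\<^sub>n z\<^sup>n / (q; q)\<^sub>n\<close>, where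
  \<open>H(z) = \<Sum>\<^sub>N q\<^bsup>N(N+1)\<^esup> e\<^sub>N z\<^sup>N\<close> and \<open>\<Sum>\<^sub>N e\<^sub>N x\<^sup>N\<close> is the product of two q-binomial series in base \<open>q\<^sup>2\<close>.
  As \<open>N\<close> tends to infinity, \<open>T\<^sub>N(0, 0)\<close> tends to \<open>H(1) / (q; q)\<^sub>\<infinity>\<close>; writing \<open>H(1)\<close> as a double sum
  and summing over one index by Euler's identity gives the claimed series.
\<close>

unbundle fps_syntax

subsection \<open>Limits of formal power series\<close>

text \<open>Convergence means that each coefficient is eventually constant, and coefficient
  \<open>n\<close> of a product involves only the coefficients up to \<open>n\<close> of the
  factors.\<close>

lemma tendsto_mult_fps:
  fixes f g :: "'b \<Rightarrow> 'a::ring fps"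
  assumes "(f \<longlongrightarrow> a) F" "(g \<longlongrightarrow> b) F"
  shows "((\<lambda>x. f x * g x) \<longlongrightarrow> a * b) F"
proof (rule tendsto_fpsI)
  fix n
  have "\<forall>\<^sub>F x in F. \<forall>i\<in>{..n}. f x $ i = a $ i \<and> g x $ i = b $ i"
    using assms by (intro eventually_ball_finite) (auto simp: tendsto_fps_iff eventually_conj_iff)
  then show "\<forall>\<^sub>F x in F. (f x * g x) $ n = (a * b) $ n"
    by eventually_elim (auto simp: fps_mult_nth intro!: sum.cong)
qed

lemma sums_mult_fps:
  fixes f :: "nat \<Rightarrow> 'a::ring fps"
  assumes "f sums s"
  shows "(\<lambda>n. c * f n) sums (c * s)"
  using assms tendsto_mult_fps[OF tendsto_const] by (auto simp: sums_def simp flip: sum_distrib_left)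

lemma sums_fpsI:
  fixes f :: "nat \<Rightarrow> 'a::ab_group_add fps"
  assumes "\<And>n k. k < n \<Longrightarrow> f n $ k = 0"
  shows "f sums Abs_fps (\<lambda>k. \<Sum>n\<le>k. f n $ k)"
  unfolding sums_def
proof (rule tendsto_fpsI)
  fix k
  have "(\<Sum>n<N. f n) $ k = (\<Sum>n\<le>k. f n $ k)" if "N > k" for N
    unfolding fps_sum_nth using that assms by (intro sum.mono_neutral_right) auto
  then show "\<forall>\<^sub>F N in sequentially. (\<Sum>n<N. f n) $ k = Abs_fps (\<lambda>k. \<Sum>n\<le>k. f n $ k) $ k"
    by (auto intro: eventually_mono[OF eventually_gt_at_top[of k]])
qed

lemma fps_limit_of_stable:
  fixes f :: "nat \<Rightarrow> 'a::ab_group_add fps"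
  assumes "\<And>n k. k \<le> n \<Longrightarrow> f (Suc n) $ k = f n $ k"
  shows "f \<longlonglongrightarrow> Abs_fps (\<lambda>k. f k $ k)"
proof (rule tendsto_fpsI)
  fix k
  have *: "f n $ k = f k $ k" if "n \<ge> k" for n
    using that by (induction rule: dec_induct) (auto simp: assms)
  show "\<forall>\<^sub>F n in sequentially. f n $ k = Abs_fps (\<lambda>k. f k $ k) $ k"
    unfolding fps_nth_Abs_fps using eventually_ge_at_top[of k] by (rule eventually_mono) (rule *)
qed

text \<open>Only terms with \<open>n \<le> k\<close> reach coefficient \<open>k\<close>, and for
  each of these finitely many \<open>n\<close> the shifted sequence \<open>r (N - n)\<close> still
  tends to \<open>R\<close>.\<close>

lemma Cauchy_product_limit_fps:
  fixes h r :: "nat \<Rightarrow> 'a::ring fps"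
  assumes h: "\<And>n k. k < n \<Longrightarrow> h n $ k = 0" and s: "h sums s" and r: "r \<longlonglongrightarrow> R"
  shows "(\<lambda>N. \<Sum>n\<le>N. h n * r (N - n)) \<longlonglongrightarrow> s * R"
proof (rule tendsto_fpsI)
  fix k
  have h0: "(h n * g) $ k = 0" if "k < n" for n g
    using that by (auto simp: fps_mult_nth h)
  have "h sums Abs_fps (\<lambda>k. \<Sum>n\<le>k. h n $ k)"
    by (rule sums_fpsI) (rule h)
  then have s_eq: "s = Abs_fps (\<lambda>k. \<Sum>n\<le>k. h n $ k)"
    using s sums_unique2 by blast
  have s_nth: "s $ i = (\<Sum>n\<le>k. h n $ i)" if "i \<le> k" for i
    unfolding s_eq fps_nth_Abs_fps using that h by (intro sum.mono_neutral_left) auto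
  have sR: "(s * R) $ k = (\<Sum>n\<le>k. (h n * R) $ k)"
  proof -
    have "(s * R) $ k = ((\<Sum>n\<le>k. h n) * R) $ k"
      by (simp add: fps_mult_nth fps_sum_nth s_nth)
    also have "\<dots> = (\<Sum>n\<le>k. (h n * R) $ k)"
      by (simp add: sum_distrib_right fps_sum_nth)
    finally show ?thesis .
  qed
  have "\<forall>\<^sub>F N in sequentially. \<forall>n\<in>{..k}. (h n * r (N - n)) $ k = (h n * R) $ k"
  proof (intro eventually_ball_finite ballI)
    fix n
    have "(\<lambda>N. r (N - n)) \<longlonglongrightarrow> R"
      by (rule LIMSEQ_offset[where k = n]) (simp add: r)
    then have "(\<lambda>N. h n * r (N - n)) \<longlonglongrightarrow> h n * R"
      by (intro tendsto_mult_fps tendsto_const)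
    then show "\<forall>\<^sub>F N in sequentially. (h n * r (N - n)) $ k = (h n * R) $ k"
      by (simp add: tendsto_fps_iff)
  qed simp
  then show "\<forall>\<^sub>F N in sequentially. (\<Sum>n\<le>N. h n * r (N - n)) $ k = (s * R) $ k"
    using eventually_ge_at_top[of k]
  proof eventually_elim
    case (elim N)
    have "(\<Sum>n\<le>N. h n * r (N - n)) $ k = (\<Sum>n\<le>k. (h n * r (N - n)) $ k)"
      unfolding fps_sum_nth using elim h0 by (intro sum.mono_neutral_right) auto
    with elim show ?case by (simp add: sR)
  qed
qed

text \<open>Coefficient \<open>k\<close> of both series is the finite sum of
  \<open>f n m $ k\<close> over \<open>n + m \<le> k\<close>, taken once by rows and once by
  antidiagonals.\<close>

lemma sums_triangle_fps:
  fixes f :: "nat \<Rightarrow> nat \<Rightarrow> 'a::ab_group_add fps"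
  assumes f: "\<And>n m k. k < n + m \<Longrightarrow> f n m $ k = 0"
    and g: "\<And>n. f n sums g n"
  shows "g sums s \<longleftrightarrow> (\<lambda>N. \<Sum>n\<le>N. f n (N - n)) sums s"
proof -
  have "f n sums Abs_fps (\<lambda>k. \<Sum>m\<le>k. f n m $ k)" for n
    by (rule sums_fpsI) (simp add: f)
  then have g_eq: "g n = Abs_fps (\<lambda>k. \<Sum>m\<le>k. f n m $ k)" for n
    using g sums_unique2 by blast
  have 1: "g sums Abs_fps (\<lambda>k. \<Sum>n\<le>k. g n $ k)"
    by (rule sums_fpsI) (simp add: g_eq f)
  have 2: "(\<lambda>N. \<Sum>n\<le>N. f n (N - n)) sums Abs_fps (\<lambda>k. \<Sum>N\<le>k. (\<Sum>n\<le>N. f n (N - n)) $ k)"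
    by (rule sums_fpsI) (simp add: fps_sum_nth f)
  have "(\<Sum>n\<le>k. g n $ k) = (\<Sum>N\<le>k. (\<Sum>n\<le>N. f n (N - n)) $ k)" for k
  proof -
    have "(\<Sum>n\<le>k. g n $ k) = (\<Sum>(n, m)\<in>{..k} \<times> {..k}. f n m $ k)"
      by (simp add: g_eq sum.cartesian_product)
    also have "\<dots> = (\<Sum>(n, m) | n + m \<le> k. f n m $ k)"
      by (rule sum.mono_neutral_right) (auto simp: not_le[symmetric] intro: f)
    finally show ?thesis
      by (simp add: sum.triangle_reindex_eq fps_sum_nth)
  qed
  with 1 2 show ?thesis
    by (metis (no_types, lifting) ext sums_unique2)
qed

subsection \<open>Dilations and the q-binomial series\<close>

lemma qpoch_0 [simp]: "qpoch a q 0 = 1"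
  by (simp add: qpoch_def)

lemma qpoch_Suc: "qpoch a q (Suc n) = qpoch a q n * (1 - a * q ^ n)"
  by (simp add: qpoch_def)

lemma qpoch_zero [simp]: "qpoch 0 q n = 1"
  by (simp add: qpoch_def)

lemma qpoch_nth_0:
  fixes a q :: "'a::comm_ring_1 fps"
  shows "a $ 0 = 0 \<Longrightarrow> qpoch a q n $ 0 = 1"
  by (induction n) (simp_all add: qpoch_Suc)

text \<open>The substitution of cz for z, written as a composition so that multiplicativity comes
  from the library.\<close>

definition dilate :: "'a::comm_ring_1 \<Rightarrow> 'a fps \<Rightarrow> 'a fps" where
  "dilate c f = fps_compose f (fps_const c * fps_X)"

lemma dilate_nth [simp]: "dilate c f $ n = c ^ n * f $ n"
  by (simp add: dilate_def)

lemma dilate_mult: "dilate c (f * g) = dilate c f * dilate c (g :: 'a::idom fps)"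
  by (simp add: dilate_def fps_compose_mult_distrib)

lemma dilate_diff: "dilate c (f - g) = dilate c f - dilate c g"
  by (simp add: fps_eq_iff algebra_simps)

lemma dilate_1 [simp]: "dilate c 1 = 1"
  by (simp add: fps_eq_iff)

lemma dilate_fps_const [simp]: "dilate c (fps_const a) = fps_const a"
  by (simp add: fps_eq_iff)

lemma dilate_fps_X [simp]: "dilate c fps_X = fps_const c * fps_X"
  by (simp add: fps_eq_iff fps_X_def)

lemma dilate_dilate: "dilate c (dilate d f) = dilate (c * d) f"
  by (simp add: fps_eq_iff power_mult_distrib mult.assoc)

text \<open>By the q-binomial theorem this is (az; q)_inf / (z; q)_inf; the product form enters only
  through the functional equation below.\<close>

definition qbinomial_series :: "'a::field fps \<Rightarrow> 'a fps \<Rightarrow> 'a fps fps" where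
  "qbinomial_series a q = Abs_fps (\<lambda>n. qpoch a q n * inverse (qpoch q q n))"

lemma qbinomial_series_functional_equation:
  fixes a q :: "'a::field fps"
  assumes "q $ 0 = 0"
  shows "(1 - fps_X) * qbinomial_series a q =
    (1 - fps_const a * fps_X) * dilate q (qbinomial_series a q)"
    (is "?L = ?R")
proof (rule fps_ext)
  fix n show "?L $ n = ?R $ n"
  proof (cases n)
    case (Suc m)
    have "qpoch q q n $ 0 \<noteq> 0" "qpoch q q m $ 0 \<noteq> 0"
      using assms by (simp_all add: qpoch_nth_0)
    then have inv: "qpoch q q n * inverse (qpoch q q n) = 1" "qpoch q q m * inverse (qpoch q q m) = 1"
      by (simp_all add: inverse_mult_eq_1')
    \<comment> \<open>The coefficients lie in a power series ring, not a field, so the factor 1 -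
      q^n is moved by inserting \<open>qpoch q q n\<close> times its inverse.\<close>
    then have "inverse (qpoch q q m) = inverse (qpoch q q m) * (qpoch q q n * inverse (qpoch q q n))"
      by simp
    also have "\<dots> = (qpoch q q m * inverse (qpoch q q m)) * (inverse (qpoch q q n) * (1 - q ^ n))"
      by (simp add: Suc qpoch_Suc mult_ac)
    finally have "inverse (qpoch q q m) = inverse (qpoch q q n) * (1 - q ^ n)"
      using inv by simp
    then have Fm: "qbinomial_series a q $ m = qpoch a q m * inverse (qpoch q q n) * (1 - q ^ n)"
      by (simp add: qbinomial_series_def mult_ac)
    have Fn: "qbinomial_series a q $ n = qpoch a q m * inverse (qpoch q q n) * (1 - a * q ^ m)"
      by (simp add: qbinomial_series_def Suc qpoch_Suc mult_ac)
    have L: "?L $ n = qbinomial_series a q $ n - qbinomial_series a q $ m"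
      by (simp add: Suc left_diff_distrib)
    have R: "?R $ n = q ^ n * qbinomial_series a q $ n - a * (q ^ m * qbinomial_series a q $ m)"
      by (simp add: Suc left_diff_distrib mult.assoc)
    show ?thesis
      unfolding L R Fm Fn by (simp add: algebra_simps)
  qed (simp add: qbinomial_series_def)
qed

subsection \<open>The bounded generating function\<close>

text \<open>
  In the series below, \<open>fps_X :: 'a fps\<close> is \<open>q\<close> and \<open>fps_X :: 'a fps fps\<close> is the second variable,
  whose exponent is the bound on the parts.
\<close>

definition e_series :: "'a::field fps fps" where
  "e_series = qbinomial_series (- (fps_X ^ 2)) (fps_X ^ 2) * dilate fps_X (qbinomial_series 0 (fps_X ^ 2))"

lemma e_series_functional_equation:
  "(1 - fps_X) * (1 - fps_const fps_X * fps_X) * e_series =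
   (1 + fps_const (fps_X ^ 2) * fps_X) * dilate (fps_X ^ 2) (e_series :: 'a::field fps fps)"
proof -
  let ?q = "fps_X :: 'a fps"
  let ?A = "qbinomial_series (- (?q ^ 2)) (?q ^ 2)" and ?B = "qbinomial_series 0 (?q ^ 2)"
  have A: "(1 - fps_X) * ?A = (1 + fps_const (?q ^ 2) * fps_X) * dilate (?q ^ 2) ?A"
    using qbinomial_series_functional_equation[of "?q ^ 2" "- (?q ^ 2)"] by (simp flip: fps_const_neg)
  have B: "(1 - fps_const ?q * fps_X) * dilate ?q ?B = dilate (?q ^ 2) (dilate ?q ?B)"
    using arg_cong[OF qbinomial_series_functional_equation[of "?q ^ 2" 0], of "dilate ?q"]
    by (simp add: dilate_mult dilate_diff dilate_dilate mult.commute)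
  have "(1 - fps_X) * (1 - fps_const ?q * fps_X) * e_series =
      ((1 - fps_X) * ?A) * ((1 - fps_const ?q * fps_X) * dilate ?q ?B)"
    unfolding e_series_def by (simp only: mult_ac)
  then show ?thesis
    unfolding A B e_series_def dilate_mult by (simp only: mult_ac)
qed

definition h_series :: "'a::field fps fps" where
  "h_series = Abs_fps (\<lambda>n. fps_X ^ (n * (n + 1)) * e_series $ n)"

lemma e_series_rec:
  fixes n :: nat
  defines "p \<equiv> fps_X ^ 2 :: 'a::field fps"
  defines "E \<equiv> (\<lambda>n. e_series $ n :: 'a fps)"
  shows "E 1 = (1 + fps_X) * E 0 + p * (E 1 + E 0)"
    and "E (n + 2) = (1 + fps_X) * E (n + 1) - fps_X * E n + p ^ (n + 2) * (E (n + 2) + E (n + 1))"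
proof -
  let ?z = "fps_X :: 'a fps fps"
  \<comment> \<open>Expanded so that powers of z stand as separate factors, which simplification
    turns into index shifts of the coefficients.\<close>
  have "fps_const fps_X * (?z * (?z * e_series)) - fps_const (1 + fps_X) * (?z * e_series) + e_series
    = dilate p e_series + fps_const p * (?z * dilate p e_series)"
    using e_series_functional_equation[where 'a = 'a] unfolding p_def
    by (simp add: algebra_simps flip: fps_const_add)
  note eq = fps_eq_iff[THEN iffD1, OF this, rule_format]
  show "E 1 = (1 + fps_X) * E 0 + p * (E 1 + E 0)"
    using eq[of 1, simplified] by (simp add: E_def algebra_simps)
  show "E (n + 2) = (1 + fps_X) * E (n + 1) - fps_X * E n + p ^ (n + 2) * (E (n + 2) + E (n + 1))"
    using eq[of "n + 2", simplified] by (simp add: E_def algebra_simps)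
qed


text \<open>Multiply the recurrence for the coefficients e_N by q^(N(N+1)). Then e_(N-1) contributes
  q^2 z h(q^2 z), e_(N-2) contributes q^6 z^2 h(q^4 z), and a further factor q^(2N) dilates by
  q^2.\<close>

lemma h_series_functional_equation:
  "h_series = (1 + fps_const (fps_X ^ 2 + fps_X ^ 3) * fps_X) * dilate (fps_X ^ 2) h_series
    + fps_const (fps_X ^ 4) * fps_X * (1 - fps_const (fps_X ^ 3) * fps_X) * dilate (fps_X ^ 4) h_series"
    (is "?L = ?R")
proof (rule fps_ext)
  fix N :: nat
  let ?q = "fps_X :: 'a fps"
  let ?E = "\<lambda>n. e_series $ n :: 'a fps"
  have R: "?R = dilate (?q ^ 2) h_series + fps_const (?q ^ 2 + ?q ^ 3) * (fps_X * dilate (?q ^ 2) h_series)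
    + fps_const (?q ^ 4) * (fps_X * dilate (?q ^ 4) h_series)
    - fps_const (?q ^ 7) * (fps_X * (fps_X * dilate (?q ^ 4) h_series))"
  proof -
    have "fps_const (?q ^ 7) = fps_const (?q ^ 3) * fps_const (?q ^ 4)"
      by (simp flip: power_add)
    then show ?thesis
      by (simp add: algebra_simps)
  qed
  consider "N = 0" | "N = 1" | n where "N = n + 2"
    by (metis One_nat_def add_2_eq_Suc' not0_implies_Suc)
  then show "?L $ N = ?R $ N"
  proof cases
    case 1
    then show ?thesis by (simp add: R)
  next
    case 2
    show ?thesis
      unfolding R 2 using e_series_rec(1)[where 'a = 'a]
      by (simp add: h_series_def power_numeral_reduce) algebra
  next
    case 3
    let ?r = "?q ^ n" and ?s = "?q ^ (n * n)"
    have p: "?q ^ (n * (n + 1)) = ?s * ?r" "?q ^ ((n + 1) * (n + 1 + 1)) = ?s * ?r ^ 3 * ?q ^ 2"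
      "?q ^ ((n + 2) * (n + 2 + 1)) = ?s * ?r ^ 5 * ?q ^ 6"
      "(?q ^ 2) ^ n = ?r ^ 2" "(?q ^ 4) ^ n = ?r ^ 4"
      unfolding power_add[symmetric] power_mult[symmetric] by (rule arg_cong[of _ _ "\<lambda>k. ?q ^ k"], simp add: algebra_simps)+
    have "?E (n + 2) = (1 + ?q) * ?E (n + 1) - ?q * ?E n + ?r ^ 2 * ?q ^ 4 * (?E (n + 2) + ?E (n + 1))"
      using e_series_rec(2)[where 'a = 'a, of n] by (simp add: power_add p(4) mult_ac)
    moreover have "?L $ N = ?s * ?r ^ 5 * ?q ^ 6 * ?E (n + 2)"
      unfolding 3 h_series_def fps_nth_Abs_fps p ..
    moreover have "?R $ N = ?r ^ 2 * ?q ^ 4 * (?s * ?r ^ 5 * ?q ^ 6 * ?E (n + 2))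
        + (?q ^ 2 + ?q ^ 3) * (?r ^ 2 * ?q ^ 2 * (?s * ?r ^ 3 * ?q ^ 2 * ?E (n + 1)))
        + ?q ^ 4 * (?r ^ 4 * ?q ^ 4 * (?s * ?r ^ 3 * ?q ^ 2 * ?E (n + 1)))
        - ?q ^ 7 * (?r ^ 4 * (?s * ?r * ?E n))"
    proof -
      have "h_series $ n = ?s * ?r * ?E n" "h_series $ (n + 1) = ?s * ?r ^ 3 * ?q ^ 2 * ?E (n + 1)"
        "h_series $ (n + 2) = ?s * ?r ^ 5 * ?q ^ 6 * ?E (n + 2)"
        unfolding h_series_def fps_nth_Abs_fps p by (rule refl)+
      then show ?thesis
        unfolding R 3 by (simp add: p power_add mult_ac)
    qed
    \<comment> \<open>The recurrence times s r^5 q^6; replacing q^n and q^(n*n) by variables leaves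
      a polynomial identity.\<close>
    moreover have "s * r ^ 5 * q ^ 6 * e2 = r ^ 2 * q ^ 4 * (s * r ^ 5 * q ^ 6 * e2)
        + (q ^ 2 + q ^ 3) * (r ^ 2 * q ^ 2 * (s * r ^ 3 * q ^ 2 * e1))
        + q ^ 4 * (r ^ 4 * q ^ 4 * (s * r ^ 3 * q ^ 2 * e1)) - q ^ 7 * (r ^ 4 * (s * r * e0))"
      if "e2 = (1 + q) * e1 - q * e0 + r ^ 2 * q ^ 4 * (e2 + e1)" for q r s e0 e1 e2 :: "'a fps"
      using that by algebra
    ultimately show ?thesis by metis
  qed
qed

section \<open>The q-difference system for u, v and w\<close>

definition u_series :: "'a::field fps fps" where
  "u_series = h_series * qbinomial_series 0 fps_X"

text \<open>
  \<open>v_series\<close> and \<open>w_series\<close> are the generating functions for one, respectively two, leading parts of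
  the first partition prescribed; they are read off from the first two recurrences, and the
  functional equation below is the third one.
\<close>

definition v_series :: "'a::field fps fps" where
  "v_series = (1 - fps_X) * u_series"

definition w_series :: "'a::field fps fps" where
  "w_series = (1 - fps_const fps_X * fps_X) * v_series
     - fps_const (fps_X ^ 2) * fps_X * dilate (fps_X ^ 2) u_series"

text \<open>With \<open>K n\<close> = 1 / (q^n z; q)_inf, every series involved is a combination of
  dilates \<open>H n\<close> times some \<open>K m\<close>. Once \<open>K 3\<close> is factored out,
  the equation for \<open>h_series\<close> collapses the remaining factor to
  \<open>2 * H 2\<close>.\<close>

lemma w_series_functional_equation:
  "(1 - fps_const (fps_X ^ 2) * fps_X) * w_series + dilate (fps_X ^ 2) w_series =
    2 * dilate (fps_X ^ 2) (v_series :: 'a::field fps fps)"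
proof -
  let ?q = "fps_X :: 'a fps" and ?z = "fps_X :: 'a fps fps"
  define K :: "nat \<Rightarrow> 'a fps fps" where "K n = dilate (?q ^ n) (qbinomial_series 0 ?q)" for n
  define H :: "nat \<Rightarrow> 'a fps fps" where "H n = dilate (?q ^ n) h_series" for n
  define c where "c = fps_const ?q"
  have K: "(1 - c ^ n * ?z) * K n = K (Suc n)" for n
    using arg_cong[OF qbinomial_series_functional_equation[of ?q 0], of "dilate (?q ^ n)"]
    by (simp add: dilate_mult dilate_diff dilate_dilate K_def c_def mult.commute fps_const_power)
  have dil: "dilate (?q ^ 2) (H 0) = H 2" "dilate (?q ^ 2) (H 2) = H 4"
    "dilate (?q ^ 2) (K 0) = K 2" "dilate (?q ^ 2) (K 1) = K 3" "dilate (?q ^ 2) (K 2) = K 4"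
    by (simp_all add: H_def K_def dilate_dilate flip: power_add power_Suc2)
  have dil_cz: "dilate (?q ^ 2) (c ^ 2) * dilate (?q ^ 2) ?z = c ^ 4 * ?z"
    by (simp add: c_def fps_const_power mult.assoc[symmetric] flip: power_add)
  have H: "H 0 = (1 + (c ^ 2 + c ^ 3) * ?z) * H 2 + c ^ 4 * ?z * (1 - c ^ 3 * ?z) * H 4"
    using h_series_functional_equation[where 'a = 'a]
    by (simp add: H_def c_def dilate_def fps_const_power flip: fps_const_add)
  have u: "u_series = H 0 * K 0"
    by (simp add: u_series_def H_def K_def dilate_def)
  have v: "v_series = H 0 * K 1"
    using K[of 0] by (simp add: v_series_def u mult_ac)
  have u2: "dilate (?q ^ 2) u_series = H 2 * K 2"
    by (simp only: u dilate_mult dil)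
  have v2: "dilate (?q ^ 2) v_series = H 2 * K 3"
    by (simp only: v dilate_mult dil)
  have w: "w_series = (H 0 - c ^ 2 * ?z * H 2) * K 2"
  proof -
    have "w_series = H 0 * ((1 - c * ?z) * K 1) - c ^ 2 * ?z * (H 2 * K 2)"
      unfolding w_series_def u2 v by (simp add: c_def fps_const_power mult_ac)
    also have "(1 - c * ?z) * K 1 = K 2"
      using K[of 1] by (simp add: numeral_2_eq_2)
    finally show ?thesis by (simp add: algebra_simps)
  qed
  have w2: "dilate (?q ^ 2) w_series = (H 2 - c ^ 4 * ?z * H 4) * K 4"
    by (simp only: w dilate_mult dilate_diff dil dil_cz)
  have K3: "(1 - c ^ 2 * ?z) * K 2 = K 3" and K4: "(1 - c ^ 3 * ?z) * K 3 = K 4"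
    using K[of 2] K[of 3] by simp_all
  have "(1 - c ^ 2 * ?z) * w_series = (H 0 - c ^ 2 * ?z * H 2) * ((1 - c ^ 2 * ?z) * K 2)"
    unfolding w by (simp only: mult_ac)
  then have "(1 - c ^ 2 * ?z) * w_series + dilate (?q ^ 2) w_series =
    (H 0 - c ^ 2 * ?z * H 2 + (H 2 - c ^ 4 * ?z * H 4) * (1 - c ^ 3 * ?z)) * K 3"
    unfolding w2 K3 K4[symmetric] by (simp only: distrib_right mult.assoc)
  also have "H 0 - c ^ 2 * ?z * H 2 + (H 2 - c ^ 4 * ?z * H 4) * (1 - c ^ 3 * ?z) = 2 * H 2"
    unfolding H by (simp add: algebra_simps)
  finally have "(1 - c ^ 2 * ?z) * w_series + dilate (?q ^ 2) w_series = 2 * dilate (?q ^ 2) v_series"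
    unfolding v2 by (simp only: mult.assoc)
  then show ?thesis
    by (simp add: c_def fps_const_power)
qed

text \<open>Induction on \<open>n\<close>: eliminating \<open>u (Suc n)\<close> shows that v and w
  deviate from the series by the same d at \<open>Suc n\<close>. The third recurrence gives (1 + Q)
  d = 2 Q d with Q = q^(2(n+1)), and 1 - Q is nonzero.\<close>

lemma u_series_unique:
  fixes u v w :: "nat \<Rightarrow> 'a::field fps"
  assumes "u 0 = 1" "v 0 = 1" "w 0 = 1"
    and u: "\<And>n. u (Suc n) = u n + v (Suc n)"
    and v: "\<And>n. (1 + fps_X ^ (2 * Suc n)) * v (Suc n) =
      fps_X * v n + w (Suc n) + fps_X ^ (2 * Suc n) * u (Suc n)"
    and w: "\<And>n. (1 + fps_X ^ (2 * Suc n)) * w (Suc n) =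
      fps_X ^ 2 * w n + 2 * fps_X ^ (2 * Suc n) * v (Suc n)"
  shows "u n = u_series $ n"
proof -
  let ?q = "fps_X :: 'a fps"
  have u': "u_series $ Suc n = u_series $ n + v_series $ Suc n" for n
    by (simp add: v_series_def left_diff_distrib)
  have v': "w_series $ Suc n = v_series $ Suc n - ?q * v_series $ n - ?q ^ (2 * Suc n) * u_series $ n" for n
    by (simp add: w_series_def left_diff_distrib mult.assoc power_add power_mult power2_eq_square)
  have w': "w_series $ Suc n - ?q ^ 2 * w_series $ n + ?q ^ (2 * Suc n) * w_series $ Suc n =
      2 * (?q ^ (2 * Suc n) * v_series $ Suc n)" for n
    using arg_cong[OF w_series_functional_equation[where 'a = 'a], of "\<lambda>f. f $ Suc n"]
    by (simp add: left_diff_distrib mult.assoc power_mult power2_eq_square numeral_fps_const)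
  have "u n = u_series $ n \<and> v n = v_series $ n \<and> w n = w_series $ n"
  proof (induction n)
    case 0
    show ?case
      using assms(1-3)
      by (simp add: v_series_def w_series_def u_series_def h_series_def e_series_def qbinomial_series_def)
  next
    case (Suc n)
    define Q where "Q = ?q ^ (2 * Suc n)"
    have "Q $ 0 = 0"
      by (simp add: Q_def)
    then have "1 - Q \<noteq> 0"
      by (metis fps_one_nth fps_sub_nth fps_zero_nth diff_zero zero_neq_one)
    note eqs = u[of n] v[of n, folded Q_def] w[of n, folded Q_def] v'[of n, folded Q_def] w'[of n, folded Q_def]
    have 1: "w (Suc n) = v (Suc n) - ?q * v n - Q * u n"
      using eqs(1,2) by (simp add: algebra_simps)
    then have 2: "w (Suc n) - w_series $ Suc n = v (Suc n) - v_series $ Suc n"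
      using eqs(4) Suc by simp
    have "(1 + Q) * (w (Suc n) - w_series $ Suc n) = 2 * Q * (v (Suc n) - v_series $ Suc n)"
      using eqs(3,5) Suc by (simp add: algebra_simps)
    then have "(1 - Q) * (v (Suc n) - v_series $ Suc n) = 0"
      unfolding 2 by (simp add: algebra_simps)
    with \<open>1 - Q \<noteq> 0\<close> have *: "v (Suc n) = v_series $ Suc n"
      by simp
    moreover have "u (Suc n) = u_series $ Suc n"
      using * u[of n] u'[of n] Suc by metis
    moreover have "w (Suc n) = w_series $ Suc n"
      using * 2 by simp
    ultimately show ?case by blast
  qed
  then show ?thesis by blast
qed

subsection \<open>Generating functions\<close>

text \<open>Since \<open>card\<close> is 0 on infinite sets, finiteness of the level sets is assumed
  separately where it matters.\<close>

definition gf :: "('b \<Rightarrow> nat) \<Rightarrow> 'b set \<Rightarrow> 'a::semiring_1 fps" where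
  "gf w S = Abs_fps (\<lambda>k. of_nat (card {x \<in> S. w x = k}))"

lemma gf_Un_Int:
  assumes "\<And>k. finite {x \<in> A. w x = k}" "\<And>k. finite {x \<in> B. w x = k}"
  shows "gf w (A \<union> B) + gf w (A \<inter> B) = gf w A + gf w B"
proof (rule fps_ext)
  fix k
  have "{x \<in> A \<union> B. w x = k} = {x \<in> A. w x = k} \<union> {x \<in> B. w x = k}"
    "{x \<in> A \<inter> B. w x = k} = {x \<in> A. w x = k} \<inter> {x \<in> B. w x = k}"
    by auto
  then show "(gf w (A \<union> B) + gf w (A \<inter> B)) $ k = (gf w A + gf w B) $ k"
    using card_Un_Int[OF assms[of k]] by (simp add: gf_def flip: of_nat_add)
qed

lemma gf_Un_disjoint:
  assumes "\<And>k. finite {x \<in> A. w x = k}" "\<And>k. finite {x \<in> B. w x = k}" "A \<inter> B = {}"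
  shows "gf w (A \<union> B) = (gf w A + gf w B :: 'c::semiring_1 fps)"
proof -
  have "gf w {} = (0 :: 'c fps)"
    by (simp add: gf_def fps_eq_iff)
  then show ?thesis
    using gf_Un_Int[OF assms(1,2)] assms(3) by (metis add.right_neutral)
qed

lemma gf_bij_betw:
  assumes f: "bij_betw f A B" and w: "\<And>x. x \<in> A \<Longrightarrow> w (f x) = w x + m"
  shows "gf w B = fps_X ^ m * gf w A"
proof (rule fps_ext)
  fix k
  have B: "B = f ` A" and inj: "inj_on f A"
    using f by (auto simp: bij_betw_def)
  have eq: "{y \<in> B. w y = k} = f ` {x \<in> A. w x + m = k}"
    using w by (auto simp: B)
  have "card {y \<in> B. w y = k} = card {x \<in> A. w x + m = k}"
    unfolding eq by (intro card_image inj_on_subset[OF inj]) auto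
  then show "gf w B $ k = (fps_X ^ m * gf w A) $ k"
    by (auto simp: gf_def fps_X_power_mult_nth intro!: arg_cong[of _ _ "\<lambda>S. of_nat (card S)"])
qed

text \<open>A finite subset of \<open>S\<close> that contains the finite level set of weight
  \<open>k\<close> already yields the final coefficient \<open>k\<close>.\<close>

lemma has_sum_gf:
  fixes S :: "'b set" and w :: "'b \<Rightarrow> nat"
  assumes fin: "\<And>k. finite {x \<in> S. w x = k}"
  shows "((\<lambda>x. fps_X ^ w x :: 'a::comm_ring_1 fps) has_sum gf w S) S"
  unfolding has_sum_def
proof (rule tendsto_fpsI)
  fix k
  let ?K = "{x \<in> S. w x = k}"
  have "(\<Sum>x\<in>T. fps_X ^ w x :: 'a fps) $ k = gf w S $ k" if "finite T" "?K \<subseteq> T" "T \<subseteq> S" for T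
  proof -
    have "(\<Sum>x\<in>T. fps_X ^ w x :: 'a fps) $ k = (\<Sum>x\<in>?K. 1)"
      unfolding fps_sum_nth using that by (intro sum.mono_neutral_cong_right) auto
    then show ?thesis
      by (simp add: gf_def)
  qed
  then show "\<forall>\<^sub>F T in finite_subsets_at_top S. (\<Sum>x\<in>T. fps_X ^ w x :: 'a fps) $ k = gf w S $ k"
    unfolding eventually_finite_subsets_at_top using fin[of k] by (intro exI[of _ ?K]) auto
qed

subsection \<open>Cylindric partitions with bounded parts\<close>

lemma partition_size_eq_sum:
  assumes "\<forall>j\<ge>n. f j = 0"
  shows "partition_size f = (\<Sum>j<n. f j)"
  unfolding partition_size_def using assms
  by (intro sum.mono_neutral_left) (auto intro: not_le_imp_less)

lemma is_partition_iff:
  "is_partition f \<longleftrightarrow> antimono f \<and> (\<exists>n. \<forall>j\<ge>n. f j = 0)"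
proof -
  have "(\<forall>j\<in>{j. f j \<noteq> 0}. j < n) \<longleftrightarrow> (\<forall>j\<ge>n. f j = 0)" for n
    using not_le by blast
  then have "finite {j. f j \<noteq> 0} \<longleftrightarrow> (\<exists>n. \<forall>j\<ge>n. f j = 0)"
    unfolding finite_nat_set_iff_bounded by presburger
  then show ?thesis by (simp add: is_partition_def)
qed

lemma partition_eventually_0:
  assumes "is_partition f"
  obtains n where "m \<le> n" "\<forall>j\<ge>n. f j = 0"
  using assms unfolding is_partition_iff by (metis max.bounded_iff max.cobounded1)

lemma partition_size_ge:
  assumes "is_partition f"
  shows "f j \<le> partition_size f"
proof -
  obtain n where n: "Suc j \<le> n" "\<forall>j\<ge>n. f j = 0"
    using partition_eventually_0[OF assms] by blast
  then show ?thesis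
    unfolding partition_size_eq_sum[OF n(2)] by (intro member_le_sum) auto
qed

text \<open>A nonzero part at index \<open>j\<close> makes the \<open>j + 1\<close> parts up to it
  at least 1, so the size exceeds \<open>j\<close>.\<close>

lemma partition_nth_ge_size:
  assumes f: "is_partition f" and j: "partition_size f \<le> j"
  shows "f j = 0"
proof (rule ccontr)
  assume "f j \<noteq> 0"
  obtain n where n: "Suc j \<le> n" "\<forall>j\<ge>n. f j = 0"
    using partition_eventually_0[OF f] by blast
  have "f i \<ge> 1" if "i \<le> j" for i
    using f \<open>f j \<noteq> 0\<close> that by (metis One_nat_def Suc_leI antimonoD bot_nat_0.not_eq_extremum is_partition_def le_zero_eq)
  then have "(\<Sum>i\<le>j. 1) \<le> (\<Sum>i\<le>j. f i)"
    by (intro sum_mono) auto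
  also have "\<dots> \<le> (\<Sum>i<n. f i)"
    using n by (intro sum_mono2) auto
  also have "\<dots> = partition_size f"
    using n by (simp add: partition_size_eq_sum)
  finally show False using j by simp
qed

lemma finite_partitions_size_le: "finite {f. is_partition f \<and> partition_size f \<le> k}"
proof (rule finite_subset)
  show "{f. is_partition f \<and> partition_size f \<le> k} \<subseteq> {f. \<forall>j. (j \<in> {..k} \<longrightarrow> f j \<in> {..k}) \<and> (j \<notin> {..k} \<longrightarrow> f j = 0)}"
  proof (intro subsetI, unfold mem_Collect_eq, intro allI conjI impI)
    fix f j assume "is_partition f \<and> partition_size f \<le> k"
    then have f: "is_partition f" "partition_size f \<le> k" by auto
    show "f j \<in> {..k}"
      using partition_size_ge[OF f(1), of j] f(2) by simp
    show "f j = 0" if "j \<notin> {..k}"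
      using partition_nth_ge_size[OF f(1), of j] f(2) that by simp
  qed
  show "finite {f. \<forall>j. (j \<in> {..k} \<longrightarrow> f j \<in> {..k}) \<and> (j \<notin> {..k} \<longrightarrow> f j = (0::nat))}"
    by (intro finite_set_of_finite_funs) auto
qed

lemma is_partition_case_nat:
  assumes "is_partition f" "\<And>j. f j \<le> N"
  shows "is_partition (case_nat N f)" "partition_size (case_nat N f) = partition_size f + N"
proof -
  obtain n where n: "0 \<le> n" "\<forall>j\<ge>n. f j = 0"
    using partition_eventually_0[OF assms(1)] by blast
  have n': "\<forall>j\<ge>Suc n. case_nat N f j = 0"
    using n by (auto split: nat.split)
  have "antimono (case_nat N f)"
    using assms unfolding is_partition_iff by (auto simp: antimono_iff_le_Suc split: nat.split)
  then show "is_partition (case_nat N f)"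
    using n' unfolding is_partition_iff by blast
  show "partition_size (case_nat N f) = partition_size f + N"
    unfolding partition_size_eq_sum[OF n'] partition_size_eq_sum[OF n(2)]
    by (simp add: sum.lessThan_Suc_shift del: sum.lessThan_Suc)
qed

lemma is_partition_comp_Suc: "is_partition f \<Longrightarrow> is_partition (f \<circ> Suc)"
  unfolding is_partition_iff by (auto simp: monotone_def) (meson le_SucI)

lemma partition_size_add_indicator:
  assumes "is_partition f"
  shows "partition_size (\<lambda>j. if j < a then f j + 1 else f j) = partition_size f + a"
proof -
  obtain n where n: "a \<le> n" "\<forall>j\<ge>n. f j = 0"
    using partition_eventually_0[OF assms(1)] by blast
  have "(\<Sum>j<n. if j < a then f j + 1 else f j) = (\<Sum>j<n. f j + (if j < a then 1 else 0))"
    by (intro sum.cong) auto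
  also have "\<dots> = (\<Sum>j<n. f j) + card ({..<n} \<inter> {j. j < a})"
    by (simp add: sum.distrib sum.If_cases)
  also have "{..<n} \<inter> {j. j < a} = {..<a}"
    using n by auto
  finally have "(\<Sum>j<n. if j < a then f j + 1 else f j) = (\<Sum>j<n. f j) + a"
    by simp
  moreover have "partition_size (\<lambda>j. if j < a then f j + 1 else f j) = (\<Sum>j<n. if j < a then f j + 1 else f j)"
    using n by (intro partition_size_eq_sum) auto
  ultimately show ?thesis
    using n by (simp add: partition_size_eq_sum)
qed

section \<open>Pairs of partitions for the profile (4, 0)\<close>

definition pair_size :: "(nat \<Rightarrow> nat) \<times> (nat \<Rightarrow> nat) \<Rightarrow> nat" where
  "pair_size = (\<lambda>(l, m). partition_size l + partition_size m)"

text \<open>The entry 0 of the profile gives the unshifted inequality, the entry 4 the cyclic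
  one.\<close>

definition cyl :: "((nat \<Rightarrow> nat) \<times> (nat \<Rightarrow> nat)) set" where
  "cyl = {(l, m). is_partition l \<and> is_partition m \<and> (\<forall>j. m j \<le> l j) \<and> (\<forall>j. l (j + 4) \<le> m j)}"

text \<open>Bounding \<open>l\<close> suffices because \<open>m\<close> lies below it. These are the
  sets counted by \<open>T\<^sub>N(a, b)\<close>.\<close>

definition bcyl :: "nat \<Rightarrow> nat \<Rightarrow> nat \<Rightarrow> ((nat \<Rightarrow> nat) \<times> (nat \<Rightarrow> nat)) set" where
  "bcyl N a b = {(l, m) \<in> cyl. (\<forall>j. l j \<le> N) \<and> (\<forall>j<a. l j = N) \<and> (\<forall>j<b. m j = N)}"

lemma bcyl_subset: "bcyl N a b \<subseteq> cyl"
  by (auto simp: bcyl_def)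

lemma finite_cyl_size_le: "finite {x \<in> cyl. pair_size x \<le> k}"
proof (rule finite_subset)
  let ?P = "{f. is_partition f \<and> partition_size f \<le> k}"
  show "{x \<in> cyl. pair_size x \<le> k} \<subseteq> ?P \<times> ?P"
    by (auto simp: cyl_def pair_size_def)
  show "finite (?P \<times> ?P)"
    using finite_partitions_size_le by blast
qed

lemma finite_bcyl_size: "finite {x \<in> bcyl N a b. pair_size x = k}"
  by (rule finite_subset[OF _ finite_cyl_size_le[of k]]) (use bcyl_subset in auto)

abbreviation bgf :: "nat \<Rightarrow> nat \<Rightarrow> nat \<Rightarrow> 'a::comm_ring_1 fps" where
  "bgf N a b \<equiv> gf pair_size (bcyl N a b)"

text \<open>Prepending a part \<open>N\<close> to both partitions shifts all inequalities by one
  index and adds \<open>2 * N\<close> to the size.\<close>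

lemma bgf_shift: "bgf N (Suc a) (Suc b) = fps_X ^ (2 * N) * bgf N a b"
proof (rule gf_bij_betw)
  let ?f = "\<lambda>(l, m). (case_nat N l, case_nat N m)"
  let ?g = "\<lambda>(l :: nat \<Rightarrow> nat, m :: nat \<Rightarrow> nat). (l \<circ> Suc, m \<circ> Suc)"
  have le: "m j \<le> N" if "(l, m) \<in> bcyl N a b" for l m a b j
    using that unfolding bcyl_def cyl_def by (auto intro: order_trans)
  have eq: "case_nat N (h \<circ> Suc) = h" if "h 0 = N" for h :: "nat \<Rightarrow> nat"
    using that by (auto split: nat.split)
  show "bij_betw ?f (bcyl N a b) (bcyl N (Suc a) (Suc b))"
  proof (rule bij_betw_byWitness[where f' = ?g])
    show "\<forall>x\<in>bcyl N a b. ?g (?f x) = x"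
      by (auto simp: fun_eq_iff)
    show "\<forall>x\<in>bcyl N (Suc a) (Suc b). ?f (?g x) = x"
      by (auto simp: bcyl_def eq)
    show "?f ` bcyl N a b \<subseteq> bcyl N (Suc a) (Suc b)"
    proof safe
      fix l m assume lm: "(l, m) \<in> bcyl N a b"
      \<comment> \<open>At \<open>j = 0\<close> the right side is the bound \<open>N\<close> itself;
        for larger \<open>j\<close> this is an old inequality.\<close>
      have "case_nat N l (j + 4) \<le> case_nat N m j" for j
        using lm by (cases j) (auto simp: bcyl_def cyl_def numeral_eq_Suc)
      then show "(case_nat N l, case_nat N m) \<in> bcyl N (Suc a) (Suc b)"
        using lm le[OF lm] by (auto simp: bcyl_def cyl_def is_partition_case_nat less_Suc_eq_0_disj split: nat.split)
    qed
    show "?g ` bcyl N (Suc a) (Suc b) \<subseteq> bcyl N a b"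
    proof safe
      fix l m assume "(l, m) \<in> bcyl N (Suc a) (Suc b)"
      moreover from this have "l (Suc j + 4) \<le> m (Suc j)" for j
        unfolding bcyl_def cyl_def by blast
      ultimately show "(l \<circ> Suc, m \<circ> Suc) \<in> bcyl N a b"
        by (auto simp: bcyl_def cyl_def is_partition_comp_Suc)
    qed
  qed
  show "pair_size (?f x) = pair_size x + 2 * N" if "x \<in> bcyl N a b" for x
  proof (cases x)
    case (Pair l m)
    then have "is_partition l" "is_partition m" "\<And>j. l j \<le> N" "\<And>j. m j \<le> N"
      using that le[of l m a b] by (auto simp: bcyl_def cyl_def)
    with Pair show ?thesis
      by (simp add: pair_size_def is_partition_case_nat(2))
  qed
qed

lemma bgf_0: "bgf 0 a b = 1"
proof (rule fps_ext)
  fix k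
  let ?z = "\<lambda>_::nat. 0::nat"
  have "is_partition ?z"
    by (simp add: is_partition_def monotone_def)
  then have "bcyl 0 a b = {(?z, ?z)}"
    by (auto simp: bcyl_def cyl_def fun_eq_iff)
  then have "{x \<in> bcyl 0 a b. pair_size x = k} = (if k = 0 then {(?z, ?z)} else {})"
    by (auto simp: pair_size_def partition_size_def)
  then show "bgf 0 a b $ k = 1 $ k"
    by (simp add: gf_def)
qed

text \<open>
  Inclusion-exclusion over whether a further part of either partition equals the bound; if none
  does, 1 can be subtracted from each of the \<open>a + b\<close> parts that do.
\<close>

lemma bgf_step:
  assumes "b \<le> a" "a \<le> b + 4"
  shows "bgf (Suc N) a b + bgf (Suc N) (Suc a) (Suc b) = (
    fps_X ^ (a + b) * bgf N a b + bgf (Suc N) (Suc a) b + bgf (Suc N) a (Suc b) :: 'a::comm_ring_1 fps)"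
proof -
  let ?M = "Suc N"
  let ?E = "{(l, m) \<in> bcyl ?M a b. l a \<noteq> ?M \<and> m b \<noteq> ?M}"
  let ?inc = "\<lambda>a (l :: nat \<Rightarrow> nat) j. if j < a then l j + 1 else l j"
  let ?dec = "\<lambda>a (l :: nat \<Rightarrow> nat) j. if j < a then l j - 1 else l j"
  let ?f = "\<lambda>(l, m). (?inc a l, ?inc b m)" and ?g = "\<lambda>(l, m). (?dec a l, ?dec b m)"
  have antimono: "h j \<le> h i" if "is_partition h" "i \<le> j" for h i j
    using that by (auto simp: is_partition_def antimono_def)
  have fin: "finite {x \<in> S. pair_size x = k}" if "S \<subseteq> bcyl ?M a b" for S k
    using that by (intro finite_subset[OF _ finite_bcyl_size[of ?M a b k]]) auto
  have E: "gf pair_size ?E = (fps_X ^ (a + b) * bgf N a b :: 'a fps)"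
  proof (rule gf_bij_betw)
    have part: "is_partition (?inc a h)" if h: "is_partition h" and le: "\<And>j. h j \<le> N" "\<And>j. j < a \<Longrightarrow> h j = N" for a h
    proof -
      have "antimono (?inc a h)"
        using le antimono[OF h] by (auto simp: antimono_def le_Suc_eq)
      moreover obtain n where "a \<le> n" "\<forall>j\<ge>n. h j = 0"
        using partition_eventually_0[OF h] by blast
      then have "\<forall>j\<ge>n. ?inc a h j = 0" by auto
      ultimately show ?thesis unfolding is_partition_iff by blast
    qed
    have part': "is_partition (?dec a h)" if h: "is_partition h" and le: "\<And>j. h j \<le> ?M" "\<And>j. j < a \<Longrightarrow> h j = ?M" "h a \<noteq> ?M" for a h
    proof -
      have "h j \<le> N" if "a \<le> j" for j
        using antimono[OF h that] le(1)[of a] le(3) by linarith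
      then have "antimono (?dec a h)"
        using le(2) antimono[OF h] by (auto simp: antimono_def)
      moreover obtain n where "a \<le> n" "\<forall>j\<ge>n. h j = 0"
        using partition_eventually_0[OF h] by blast
      then have "\<forall>j\<ge>n. ?dec a h j = 0" by auto
      ultimately show ?thesis unfolding is_partition_iff by blast
    qed
    show "bij_betw ?f (bcyl N a b) ?E"
    proof (rule bij_betw_byWitness[where f' = ?g])
      show "\<forall>x\<in>bcyl N a b. ?g (?f x) = x"
        by (auto simp: fun_eq_iff)
      show "\<forall>x\<in>?E. ?f (?g x) = x"
        by (auto simp: fun_eq_iff bcyl_def)
      show "?f ` bcyl N a b \<subseteq> ?E"
      proof safe
        fix l m assume "(l, m) \<in> bcyl N a b"
        then have lm: "is_partition l" "is_partition m" "\<And>j. m j \<le> l j" "\<And>j. l (j + 4) \<le> m j"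
          "\<And>j. l j \<le> N" "\<And>j. j < a \<Longrightarrow> l j = N" "\<And>j. j < b \<Longrightarrow> m j = N"
          by (auto simp: bcyl_def cyl_def)
        have m_le: "m j \<le> N" for j
          using lm(3,5) order_trans by blast
        \<comment> \<open>An increment on the left is matched on the right: \<open>j + 4 < a\<close>
          forces \<open>j < b\<close> by \<open>a \<le> b + 4\<close>. The next inequality uses
          \<open>b \<le> a\<close> in the same way.\<close>
        have "?inc a l (j + 4) \<le> ?inc b m j" for j
          using lm(4,5,7)[of j] lm(5)[of "j + 4"] assms by auto
        moreover have "?inc b m j \<le> ?inc a l j" for j
          using lm(3)[of j] assms by auto
        ultimately show "(?inc a l, ?inc b m) \<in> bcyl ?M a b"
          using lm m_le by (auto simp: bcyl_def cyl_def part le_Suc_eq)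
        show False if "?inc a l a = ?M" using that lm(5)[of a] by simp
        show False if "?inc b m b = ?M" using that m_le[of b] by simp
      qed
      show "?g ` ?E \<subseteq> bcyl N a b"
      proof safe
        fix l m assume "(l, m) \<in> bcyl ?M a b" and ne: "l a \<noteq> ?M" "m b \<noteq> ?M"
        then have lm: "is_partition l" "is_partition m" "\<And>j. m j \<le> l j" "\<And>j. l (j + 4) \<le> m j"
          "\<And>j. l j \<le> ?M" "\<And>j. j < a \<Longrightarrow> l j = ?M" "\<And>j. j < b \<Longrightarrow> m j = ?M"
          by (auto simp: bcyl_def cyl_def)
        have m_le: "m j \<le> ?M" for j
          using lm(3,5) order_trans by blast
        have l_lt: "l j \<le> N" if "a \<le> j" for j
          using antimono[OF lm(1) that] ne(1) lm(5)[of a] by linarith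
        have m_lt: "m j \<le> N" if "b \<le> j" for j
          using antimono[OF lm(2) that] ne(2) m_le[of b] by linarith
        have "?dec a l (j + 4) \<le> ?dec b m j" for j
          using lm(4)[of j] lm(7)[of j] lm(6)[of "j + 4"] l_lt[of "j + 4"] assms by auto
        moreover have "?dec b m j \<le> ?dec a l j" for j
          using lm(3)[of j] lm(6)[of j] m_lt[of j] assms by auto
        moreover have "?dec a l j \<le> N" for j
          using lm(6)[of j] l_lt[of j] by auto
        ultimately show "(?dec a l, ?dec b m) \<in> bcyl N a b"
          using lm m_le ne by (auto simp: bcyl_def cyl_def part')
      qed
    qed
    show "pair_size (?f x) = pair_size x + (a + b)" if "x \<in> bcyl N a b" for x
      using that by (auto simp: pair_size_def bcyl_def cyl_def partition_size_add_indicator)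
  qed
  have eq: "bcyl ?M a b = ?E \<union> (bcyl ?M (Suc a) b \<union> bcyl ?M a (Suc b))"
    "?E \<inter> (bcyl ?M (Suc a) b \<union> bcyl ?M a (Suc b)) = {}"
    "bcyl ?M (Suc a) b \<inter> bcyl ?M a (Suc b) = bcyl ?M (Suc a) (Suc b)"
    by (auto simp: bcyl_def less_Suc_eq)
  have sub: "bcyl ?M (Suc a) b \<subseteq> bcyl ?M a b" "bcyl ?M a (Suc b) \<subseteq> bcyl ?M a b" "?E \<subseteq> bcyl ?M a b"
    by (auto simp: bcyl_def)
  have "(bgf ?M a b :: 'a fps) = gf pair_size ?E + gf pair_size (bcyl ?M (Suc a) b \<union> bcyl ?M a (Suc b))"
    by (subst eq(1), intro gf_Un_disjoint[OF fin fin]) (use sub eq(2) in auto)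
  moreover have "gf pair_size (bcyl ?M (Suc a) b \<union> bcyl ?M a (Suc b)) + bgf ?M (Suc a) (Suc b) =
      (bgf ?M (Suc a) b + bgf ?M a (Suc b) :: 'a fps)"
    using gf_Un_Int[of "bcyl ?M (Suc a) b" pair_size "bcyl ?M a (Suc b)"] sub
    by (simp add: fin eq(3))
  ultimately show ?thesis
    by (simp add: E add.assoc)
qed

text \<open>At the ends of the range of \<open>bgf_step\<close> the interlacing forces one more part
  to be \<open>N\<close>: \<open>l (b + 4) \<le> m b\<close> in the first case,
  \<open>m a \<le> l a\<close> in the second. This closes the recurrences.\<close>

lemma bcyl_boundary:
  "bcyl N (b + 5) b = bcyl N (b + 5) (Suc b)"
  "bcyl N a (Suc a) = bcyl N (Suc a) (Suc a)"
proof -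
  have "m b = N" if lm: "(l, m) \<in> bcyl N (b + 5) b" for l m
  proof -
    have "\<forall>j. l (j + 4) \<le> m j" "\<forall>j. m j \<le> l j" "\<forall>j. l j \<le> N" "\<forall>j<b + 5. l j = N"
      using lm unfolding bcyl_def cyl_def by blast+
    from this(1,2,3)[rule_format, of b] this(4)[rule_format, of "b + 4"] show ?thesis by linarith
  qed
  then show "bcyl N (b + 5) b = bcyl N (b + 5) (Suc b)"
    unfolding bcyl_def by (auto simp: less_Suc_eq)
  have "l a = N" if lm: "(l, m) \<in> bcyl N a (Suc a)" for l m
  proof -
    have "\<forall>j. m j \<le> l j" "\<forall>j. l j \<le> N" "\<forall>j<Suc a. m j = N"
      using lm unfolding bcyl_def cyl_def by blast+
    from this[rule_format, of a] show ?thesis by linarith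
  qed
  then show "bcyl N a (Suc a) = bcyl N (Suc a) (Suc a)"
    unfolding bcyl_def by (auto simp: less_Suc_eq)
qed


text \<open>\<open>bgf_shift\<close> reduces everything to \<open>b = 0\<close>, and the boundary
  cases leave a system for \<open>d\<close> from 0 to 4. Its symmetry expresses \<open>f 3\<close>
  and \<open>f 4\<close> by \<open>f 1\<close> and \<open>f 0\<close>, so \<open>f 0\<close>,
  \<open>f 1\<close>, \<open>f 2\<close> satisfy the system of
  \<open>u_series_unique\<close>.\<close>

lemma bgf_u_series: "bgf N 0 0 = (u_series $ N :: 'a::field fps)"
proof -
  define f :: "nat \<Rightarrow> nat \<Rightarrow> 'a fps" where "f d N = bgf N d 0" for d N
  let ?Q = "\<lambda>N. fps_X ^ (2 * N) :: 'a fps"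
  have shift: "bgf N (Suc d) (Suc 0) = ?Q N * f d N" for N d
    by (simp add: bgf_shift f_def)
  have f0: "f 0 (Suc n) = f 0 n + f 1 (Suc n)" for n
    using bgf_step[of 0 0 n, where 'a = 'a] bcyl_boundary(2)[of "Suc n" 0] by (simp add: f_def)
  have mid: "(1 + ?Q (Suc n)) * f (Suc d) (Suc n) =
      fps_X ^ Suc d * f (Suc d) n + f (Suc (Suc d)) (Suc n) + ?Q (Suc n) * f d (Suc n)" if "d < 3" for n d
    using bgf_step[of 0 "Suc d" n, where 'a = 'a, unfolded shift] that by (simp add: f_def algebra_simps)
  have f4: "f 4 (Suc n) = fps_X ^ 4 * f 4 n + ?Q (Suc n) * f 3 (Suc n)" for n
    using bgf_step[of 0 4 n, where 'a = 'a] shift[of "Suc n" 3] bcyl_boundary(1)[of "Suc n" 0]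
    by (simp add: f_def)
  have Q_Suc: "?Q (Suc n) = fps_X ^ 2 * ?Q n" for n
    by (simp flip: power_add)
  \<comment> \<open>the reflection exchanging the two partitions, derived from the recurrences instead of a bijection\<close>
  have sym: "f 3 n = ?Q n * f 1 n \<and> f 4 n = ?Q n ^ 2 * f 0 n" for n
  proof (induction n)
    case 0
    then show ?case by (simp add: f_def bgf_0)
  next
    case (Suc n)
    define Q where "Q = ?Q (Suc n)"
    define D3 where "D3 = f 3 (Suc n) - Q * f 1 (Suc n)"
    define D4 where "D4 = f 4 (Suc n) - Q ^ 2 * f 0 (Suc n)"
    have IH: "fps_X ^ 2 * f 3 n = Q * f 1 n" "fps_X ^ 4 * f 4 n = Q ^ 2 * f 0 n"
      using Suc unfolding Q_def Q_Suc by (simp_all add: power_mult_distrib mult.assoc flip: power_mult)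
    have "D4 = Q * D3"
      unfolding D4_def D3_def using f4[of n, folded Q_def] f0[of n] IH(2) by (simp add: algebra_simps power2_eq_square)
    \<comment> \<open>Subtracting \<open>Q\<close> times the recurrence for \<open>f 1\<close> from
      that for \<open>f 3\<close> cancels \<open>f 2\<close>. With \<open>D4 = Q * D3\<close> this
      leaves \<open>D3 = 0\<close>.\<close>
    moreover have "(1 + Q) * D3 = D4"
    proof -
      have "(1 + Q) * f 3 (Suc n) = fps_X * (Q * f 1 n) + f 4 (Suc n) + Q * f 2 (Suc n)"
        using mid[of 2 n, folded Q_def] IH(1) by (simp add: eval_nat_numeral mult_ac)
      moreover have "(1 + Q) * f 1 (Suc n) = fps_X * f 1 n + f 2 (Suc n) + Q * f 0 (Suc n)"
        using mid[of 0 n, folded Q_def] by (simp add: eval_nat_numeral)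
      ultimately show ?thesis
        unfolding D3_def D4_def by algebra
    qed
    ultimately have "D3 = 0" "D4 = 0"
      by (simp_all add: ring_distribs)
    then show ?case
      by (simp add: D3_def D4_def Q_def)
  qed
  show ?thesis
  proof -
    have "f 0 N = u_series $ N"
    proof (rule u_series_unique[where v = "f 1" and w = "f 2"])
      show "f 0 0 = 1" "f 1 0 = 1" "f 2 0 = 1"
        by (simp_all add: f_def bgf_0)
      show "f 0 (Suc n) = f 0 n + f 1 (Suc n)" for n
        by (rule f0)
      show "(1 + ?Q (Suc n)) * f 1 (Suc n) = fps_X * f 1 n + f 2 (Suc n) + ?Q (Suc n) * f 0 (Suc n)" for n
        using mid[of 0 n] by (simp add: eval_nat_numeral)
      \<comment> \<open>The factor 2 arises because the symmetry turns \<open>f 3\<close> into a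
        second copy of the \<open>f 1\<close> term.\<close>
      show "(1 + ?Q (Suc n)) * f 2 (Suc n) = fps_X ^ 2 * f 2 n + 2 * ?Q (Suc n) * f 1 (Suc n)" for n
        using mid[of 1 n] sym[of "Suc n"] by (simp add: eval_nat_numeral algebra_simps)
    qed
    then show ?thesis by (simp add: f_def)
  qed
qed

subsection \<open>Letting the bound tend to infinity\<close>

lemma tendsto_add_fps:
  fixes f g :: "'b \<Rightarrow> 'a::ab_group_add fps"
  assumes "(f \<longlongrightarrow> a) F" "(g \<longlongrightarrow> b) F"
  shows "((\<lambda>x. f x + g x) \<longlongrightarrow> a + b) F"
proof (rule tendsto_fpsI)
  fix n
  have "\<forall>\<^sub>F x in F. f x $ n = a $ n" "\<forall>\<^sub>F x in F. g x $ n = b $ n"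
    using assms by (auto simp: tendsto_fps_iff)
  then show "\<forall>\<^sub>F x in F. (f x + g x) $ n = (a + b) $ n"
    by eventually_elim simp
qed

text \<open>The new factor 1 - q^(n+1) leaves the coefficients up to \<open>n\<close>
  unchanged.\<close>

lemma qpoch_X_tendsto:
  "(\<lambda>n. qpoch fps_X fps_X n) \<longlonglongrightarrow> qpoch_inf fps_X (fps_X :: 'a::comm_ring_1 fps)"
  "qpoch_inf fps_X (fps_X :: 'a fps) $ 0 = 1"
proof -
  let ?P = "Abs_fps (\<lambda>k. qpoch fps_X (fps_X :: 'a fps) k $ k)"
  have "(\<lambda>n. qpoch fps_X fps_X n) \<longlonglongrightarrow> ?P"
  proof (rule fps_limit_of_stable)
    fix n k :: nat assume "k \<le> n"
    then have "(qpoch fps_X (fps_X :: 'a fps) n * fps_X ^ Suc n) $ k = 0"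
      by (simp only: fps_X_power_mult_right_nth) simp
    then show "qpoch fps_X (fps_X :: 'a fps) (Suc n) $ k = qpoch fps_X fps_X n $ k"
      by (simp add: qpoch_Suc right_diff_distrib)
  qed
  moreover from this have "qpoch_inf fps_X (fps_X :: 'a fps) = ?P"
    unfolding qpoch_inf_def by (rule limI)
  ultimately show "(\<lambda>n. qpoch fps_X fps_X n) \<longlonglongrightarrow> qpoch_inf fps_X (fps_X :: 'a fps)"
    "qpoch_inf fps_X (fps_X :: 'a fps) $ 0 = 1"
    by simp_all
qed

lemma h_series_nth_eq_0: "k < n \<Longrightarrow> h_series $ n $ k = (0 :: 'a::field)"
  by (simp add: h_series_def fps_X_power_mult_nth)

text \<open>No part exceeds the total size, so the bound \<open>N\<close> excludes nothing of size
  \<open>k \<le> N\<close>.\<close>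

lemma gf_cyl_limit: "(\<lambda>N. bgf N 0 0) \<longlonglongrightarrow> (gf pair_size cyl :: 'a::comm_ring_1 fps)"
proof (rule tendsto_fpsI)
  fix k
  have "(bgf N 0 0 :: 'a fps) $ k = gf pair_size cyl $ k" if "k \<le> N" for N
  proof -
    have "{x \<in> bcyl N 0 0. pair_size x = k} = {x \<in> cyl. pair_size x = k}"
    proof (intro set_eqI iffI)
      fix x assume "x \<in> {x \<in> cyl. pair_size x = k}"
      moreover obtain l m where "x = (l, m)" by fastforce
      moreover have "l j \<le> N" if "is_partition l" "partition_size l + partition_size m = k" for j
        using partition_size_ge[OF that(1), of j] that(2) \<open>k \<le> N\<close> by linarith
      ultimately show "x \<in> {x \<in> bcyl N 0 0. pair_size x = k}"
        by (auto simp: bcyl_def cyl_def pair_size_def)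
    qed (use bcyl_subset in auto)
    then show ?thesis by (simp add: gf_def)
  qed
  then show "\<forall>\<^sub>F N in sequentially. (bgf N 0 0 :: 'a fps) $ k = gf pair_size cyl $ k"
    by (rule eventually_mono[OF eventually_ge_at_top])
qed

lemma gf_cyl_eq:
  assumes "(\<lambda>n. h_series $ n) sums s"
  shows "gf pair_size cyl = s * inverse (qpoch_inf fps_X (fps_X :: 'a::field fps))"
proof -
  let ?r = "\<lambda>n. inverse (qpoch fps_X fps_X n) :: 'a fps"
  have "?r \<longlonglongrightarrow> inverse (qpoch_inf fps_X fps_X)"
    by (intro tendsto_inverse_fps qpoch_X_tendsto) (simp add: qpoch_X_tendsto)
  then have "(\<lambda>N. \<Sum>n\<le>N. h_series $ n * ?r (N - n)) \<longlonglongrightarrow> s * inverse (qpoch_inf fps_X fps_X)"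
    using assms by (intro Cauchy_product_limit_fps h_series_nth_eq_0)
  also have "(\<lambda>N. \<Sum>n\<le>N. h_series $ n * ?r (N - n)) = (\<lambda>N. bgf N 0 0)"
    by (simp add: bgf_u_series u_series_def fps_mult_nth qbinomial_series_def atMost_atLeast0)
  finally show ?thesis
    using gf_cyl_limit LIMSEQ_unique by blast
qed

text \<open>Euler's series for \<open>(-q\<^bsup>2n+3\<^esup>; q\<^sup>2)\<^sub>\<infinity>\<close>.\<close>

definition euler_term :: "nat \<Rightarrow> nat \<Rightarrow> 'a::field fps" where
  "euler_term n m = fps_X ^ (m * m + 2 * m + 2 * n * m) * inverse (qpoch (fps_X ^ 2) (fps_X ^ 2) m)"

definition euler_sum :: "nat \<Rightarrow> 'a::field fps" where
  "euler_sum n = Abs_fps (\<lambda>k. \<Sum>m\<le>k. euler_term n m $ k)"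

lemma euler_term_sums: "euler_term n sums euler_sum n"
  unfolding euler_sum_def by (rule sums_fpsI) (simp add: euler_term_def fps_X_power_mult_nth)

text \<open>The difference of the terms \<open>m + 1\<close> for \<open>n\<close> and
  \<open>Suc n\<close> carries the factor 1 - q^(2(m+1)). It cancels the last factor of the
  denominator and leaves q^(2n+3) times term \<open>m\<close> for \<open>Suc n\<close>.\<close>

lemma euler_sum_step:
  "euler_sum n = (1 + fps_X ^ (2 * n + 3)) * (euler_sum (Suc n) :: 'a::field fps)"
proof -
  let ?q = "fps_X :: 'a fps"
  have step: "euler_term n (Suc m) = euler_term (Suc n) (Suc m) + ?q ^ (2 * n + 3) * euler_term (Suc n) m" for m
  proof -
    let ?P = "qpoch (?q ^ 2) (?q ^ 2)" and ?c = "1 - (?q ^ 2) ^ Suc m"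
    have "?c $ 0 \<noteq> 0" "?P m $ 0 \<noteq> 0"
      by (simp_all add: qpoch_nth_0)
    then have c: "inverse (?P (Suc m)) * ?c = inverse (?P m)"
      by (simp add: qpoch_Suc fps_inverse_mult inverse_mult_eq_1 mult.assoc)
    let ?e = "Suc m * Suc m + 2 * Suc m + 2 * n * Suc m"
    have "euler_term (Suc n) (Suc m) = ?q ^ ?e * (?q ^ 2) ^ Suc m * inverse (?P (Suc m))"
      unfolding euler_term_def power_add[symmetric] power_mult[symmetric]
      by (intro arg_cong2[of _ _ _ _ "(*)"] arg_cong[of _ _ "\<lambda>k. ?q ^ k"]) (simp_all add: algebra_simps)
    moreover have "euler_term n (Suc m) = ?q ^ ?e * inverse (?P (Suc m))"
      by (simp only: euler_term_def)
    moreover have "x * i - x * y * i = x * (i * (1 - y))" for x i y :: "'a fps"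
      by (simp add: algebra_simps)
    ultimately have "euler_term n (Suc m) - euler_term (Suc n) (Suc m) = ?q ^ ?e * (inverse (?P (Suc m)) * ?c)"
      by presburger
    also have "\<dots> = ?q ^ (2 * n + 3) * euler_term (Suc n) m"
      unfolding c euler_term_def mult.assoc[symmetric] power_add[symmetric]
      by (intro arg_cong2[of _ _ _ _ "(*)"] arg_cong[of _ _ "\<lambda>k. ?q ^ k"]) (simp_all add: algebra_simps)
    finally show ?thesis by (simp add: algebra_simps)
  qed
  have "(\<Sum>m<Suc M. euler_term n m) = (\<Sum>m<Suc M. euler_term (Suc n) m) +
      ?q ^ (2 * n + 3) * (\<Sum>m<M. euler_term (Suc n) m)" for M
    by (induction M) (simp_all add: step algebra_simps euler_term_def[of _ 0])
  moreover have "(\<lambda>M. (\<Sum>m<Suc M. euler_term (Suc n) m) + ?q ^ (2 * n + 3) * (\<Sum>m<M. euler_term (Suc n) m))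
      \<longlonglongrightarrow> euler_sum (Suc n) + ?q ^ (2 * n + 3) * euler_sum (Suc n)"
    using euler_term_sums[of "Suc n", unfolded sums_def]
    by (intro tendsto_add_fps tendsto_mult_fps tendsto_const LIMSEQ_Suc)
  moreover have "(\<lambda>M. \<Sum>m<Suc M. euler_term n m) \<longlonglongrightarrow> (euler_sum n :: 'a fps)"
    using euler_term_sums[of n, unfolded sums_def] by (rule LIMSEQ_Suc)
  ultimately show ?thesis
    by (simp add: LIMSEQ_unique distrib_right)
qed

lemma euler_sum_nth_0: "euler_sum n $ 0 = (1 :: 'a::field)"
  by (simp add: euler_sum_def euler_term_def)

text \<open>All terms with \<open>m > 0\<close> have order greater than \<open>n\<close>, so only
  the term 1 survives in low degrees.\<close>

lemma euler_sum_tendsto_1: "euler_sum \<longlonglongrightarrow> (1 :: 'a::field fps)"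
proof (rule tendsto_fpsI)
  fix k
  have "euler_sum n $ k = (1 :: 'a fps) $ k" if "k < n" for n
  proof -
    have "(euler_term n m :: 'a fps) $ k = (if m = 0 then 1 $ k else 0)" for m
    proof (cases m)
      case (Suc j)
      then have "k < m * m + 2 * m + 2 * n * m"
        using that by simp
      then have "(euler_term n m :: 'a fps) $ k = 0"
        unfolding euler_term_def fps_X_power_mult_nth by (rule if_P)
      with Suc show ?thesis by simp
    qed (simp add: euler_term_def)
    then show ?thesis
      by (simp add: euler_sum_def sum.delta)
  qed
  then show "\<forall>\<^sub>F n in sequentially. euler_sum n $ k = (1 :: 'a fps) $ k"
    by (rule eventually_mono[OF eventually_gt_at_top])
qed

lemma qpoch_mult_euler_sum:
  "qpoch (- (fps_X ^ 3)) (fps_X ^ 2) n * euler_sum n = (euler_sum 0 :: 'a::field fps)"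
proof (induction n)
  case (Suc n)
  have "1 - - (fps_X ^ 3) * (fps_X ^ 2) ^ n = (1 + fps_X ^ (2 * n + 3) :: 'a fps)"
    by (simp add: power_add mult.commute flip: power_mult)
  with Suc show ?case
    unfolding qpoch_Suc by (simp add: euler_sum_step[of n] mult.assoc)
qed simp

text \<open>The finite product times the tail \<open>euler_sum n\<close> does not depend on
  \<open>n\<close>, and the tail tends to 1.\<close>

lemma qpoch_inf_eq_euler_sum: "qpoch_inf (- (fps_X ^ 3)) (fps_X ^ 2) = (euler_sum 0 :: 'a::field fps)"
proof -
  have "qpoch (- (fps_X ^ 3)) (fps_X ^ 2) n = euler_sum 0 * inverse (euler_sum n :: 'a fps)" for n
    unfolding qpoch_mult_euler_sum[of n, symmetric]
    by (simp add: mult.assoc inverse_mult_eq_1' euler_sum_nth_0)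
  moreover have "(\<lambda>n. euler_sum 0 * inverse (euler_sum n)) \<longlonglongrightarrow> euler_sum 0 * inverse (1 :: 'a fps)"
    by (intro tendsto_mult_fps tendsto_inverse_fps tendsto_const euler_sum_tendsto_1) simp
  ultimately have "(\<lambda>n. qpoch (- (fps_X ^ 3)) (fps_X ^ 2) n) \<longlonglongrightarrow> (euler_sum 0 :: 'a fps)"
    by simp
  then show ?thesis
    unfolding qpoch_inf_def by (rule limI)
qed

text \<open>Expanding e_N as a Cauchy product makes H(1) a double sum over n and m. Its inner sum
  over m is \<open>euler_sum n\<close>, that is, (-q^3; q^2)_inf / (-q^3; q^2)_n.\<close>

lemma h_series_sums:
  fixes q :: "'a::field fps"
  defines "q \<equiv> fps_X"
  shows "(\<lambda>n. h_series $ n) sums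
    ((\<Sum>n. q ^ (n * (n + 1)) * qpoch (- (q ^ 2)) (q ^ 2) n
        / (qpoch (- (q ^ 3)) (q ^ 2) n * qpoch (q ^ 2) (q ^ 2) n)) * qpoch_inf (- (q ^ 3)) (q ^ 2))"
proof -
  let ?A = "\<lambda>n. q ^ (n * (n + 1)) * (qpoch (- (q ^ 2)) (q ^ 2) n * inverse (qpoch (q ^ 2) (q ^ 2) n))"
  let ?t = "\<lambda>n. q ^ (n * (n + 1)) * qpoch (- (q ^ 2)) (q ^ 2) n
        / (qpoch (- (q ^ 3)) (q ^ 2) n * qpoch (q ^ 2) (q ^ 2) n)"
  define s :: "'a fps" where "s = Abs_fps (\<lambda>k. \<Sum>n\<le>k. h_series $ n $ k)"
  have s: "(\<lambda>n. h_series $ n) sums s"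
    unfolding s_def by (rule sums_fpsI) (rule h_series_nth_eq_0)
  \<comment> \<open>The exponents agree since (n+m)(n+m+1) + m = n(n+1) + m^2 + 2m + 2nm.\<close>
  have AB: "?A n * euler_term n m = q ^ ((n + m) * (n + m + 1)) *
      (qpoch (- (q ^ 2)) (q ^ 2) n * inverse (qpoch (q ^ 2) (q ^ 2) n) * (q ^ m * inverse (qpoch (q ^ 2) (q ^ 2) m)))" for n m
  proof -
    have "q ^ (n * (n + 1)) * q ^ (m * m + 2 * m + 2 * n * m) = q ^ ((n + m) * (n + m + 1)) * q ^ m"
      unfolding power_add[symmetric] by (rule arg_cong[of _ _ "\<lambda>k. q ^ k"]) (simp add: algebra_simps)
    moreover have "x * a * (y * c) = z * (a * (w * c))" if "x * y = z * w" for x y z w a c :: "'a fps"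
      using arg_cong[OF that, of "\<lambda>t. t * (a * c)"] by (simp only: mult_ac)
    ultimately show ?thesis
      unfolding euler_term_def q_def by blast
  qed
  have "(\<Sum>n\<le>N. ?A n * euler_term n (N - n)) = h_series $ N" for N
  proof -
    have "h_series $ N = (\<Sum>n\<le>N. q ^ (N * (N + 1)) * (qpoch (- (q ^ 2)) (q ^ 2) n * inverse (qpoch (q ^ 2) (q ^ 2) n) *
        (q ^ (N - n) * inverse (qpoch (q ^ 2) (q ^ 2) (N - n)))))"
      by (simp add: h_series_def e_series_def fps_mult_nth qbinomial_series_def q_def sum_distrib_left atMost_atLeast0)
    also have "\<dots> = (\<Sum>n\<le>N. ?A n * euler_term n (N - n))"
      by (intro sum.cong refl) (simp only: AB atMost_iff le_add_diff_inverse)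
    finally show ?thesis ..
  qed
  moreover have "(?A n * euler_term n m) $ k = 0" if "k < n + m" for n m k
  proof -
    have "k < (n + m) * (n + m + 1)" using that by simp
    then show ?thesis
      unfolding AB unfolding q_def by (simp only: fps_X_power_mult_nth) simp
  qed
  moreover have "(\<lambda>m. ?A n * euler_term n m) sums (?A n * euler_sum n)" for n
    by (intro sums_mult_fps euler_term_sums)
  ultimately have "(\<lambda>n. ?A n * euler_sum n) sums s"
    using sums_triangle_fps[of "\<lambda>n m. ?A n * euler_term n m" "\<lambda>n. ?A n * euler_sum n" s] s by simp
  \<comment> \<open>Dividing by the infinite product \<open>euler_sum 0\<close> turns each
    \<open>euler_sum n\<close> into the finite denominator of the claimed series.\<close>
  then have "(\<lambda>n. inverse (euler_sum 0) * (?A n * euler_sum n)) sums (inverse (euler_sum 0) * s)"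
    by (rule sums_mult_fps)
  also have "(\<lambda>n. inverse (euler_sum 0) * (?A n * euler_sum n)) = ?t"
  proof
    fix n
    have nz: "qpoch (- (q ^ 3)) (q ^ 2) n $ 0 \<noteq> 0" "qpoch (q ^ 2) (q ^ 2) n $ 0 \<noteq> 0" "(euler_sum n :: 'a fps) $ 0 \<noteq> 0"
      by (simp_all add: q_def qpoch_nth_0 euler_sum_nth_0)
    have "inverse (euler_sum 0) * euler_sum n = inverse (qpoch (- (q ^ 3)) (q ^ 2) n)"
      unfolding qpoch_mult_euler_sum[of n, symmetric] fps_inverse_mult q_def
      using nz(3) by (simp add: inverse_mult_eq_1 mult.assoc)
    moreover have "x * (a * y) = a * z" if "x * y = z" for x y z a :: "'a fps"
      using that by (simp add: mult.left_commute)
    ultimately have "inverse (euler_sum 0) * (?A n * euler_sum n) = ?A n * inverse (qpoch (- (q ^ 3)) (q ^ 2) n)"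
      by blast
    also have "\<dots> = ?t n"
      using nz by (simp add: fps_divide_unit fps_inverse_mult mult_ac)
    finally show "inverse (euler_sum 0) * (?A n * euler_sum n) = ?t n" .
  qed
  finally have t: "suminf ?t = inverse (euler_sum 0) * s"
    by (rule sums_unique[symmetric])
  have "suminf ?t * qpoch_inf (- (q ^ 3)) (q ^ 2) = inverse (euler_sum 0) * euler_sum 0 * s"
    unfolding t by (simp only: q_def qpoch_inf_eq_euler_sum mult_ac)
  also have "\<dots> = s"
    by (simp add: inverse_mult_eq_1 euler_sum_nth_0)
  finally have "suminf ?t * qpoch_inf (- (q ^ 3)) (q ^ 2) = s" .
  with s show ?thesis by simp
qed

section \<open>Transfer to cylindric partitions\<close>

lemma cylindric_partitions_4_0: "cylindric_partitions [4, 0] = (\<lambda>(l, m). [l, m]) ` cyl"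
proof (intro set_eqI iffI)
  fix L assume L: "L \<in> cylindric_partitions [4, 0]"
  then obtain l m where "L = [l, m]"
    by (auto simp: cylindric_partitions_def length_Suc_conv)
  with L show "L \<in> (\<lambda>(l, m). [l, m]) ` cyl"
    by (auto simp: cylindric_partitions_def cyl_def less_Suc_eq intro!: image_eqI[where x = "(l, m)"])
qed (auto simp: cylindric_partitions_def cyl_def less_Suc_eq)

theorem theorem5p1:
  fixes q :: "rat fps"
  assumes "q = fps_X"
  shows "((\<lambda>\<Lambda>. q ^ cylindric_size \<Lambda>) has_sum
     (\<Sum>n. q ^ (n * (n + 1)) * qpoch (- (q ^ 2)) (q ^ 2) n
            / (qpoch (- (q ^ 3)) (q ^ 2) n * qpoch (q ^ 2) (q ^ 2) n))
       * (qpoch_inf (- (q ^ 3)) (q ^ 2) / qpoch_inf q q))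
     (cylindric_partitions [4, 0])"
proof -
  have fin: "finite {x \<in> cyl. pair_size x = k}" for k
    by (rule finite_subset[OF _ finite_cyl_size_le[of k]]) auto
  have inj: "inj_on (\<lambda>(l, m). [l, m]) cyl"
    by (auto simp: inj_on_def)
  have size: "(\<lambda>\<Lambda>. q ^ cylindric_size \<Lambda>) \<circ> (\<lambda>(l, m). [l, m]) = (\<lambda>x. fps_X ^ pair_size x)"
    by (auto simp: fun_eq_iff assms cylindric_size_def pair_size_def)
  have "((\<lambda>\<Lambda>. q ^ cylindric_size \<Lambda>) has_sum gf pair_size cyl) (cylindric_partitions [4, 0])"
    unfolding cylindric_partitions_4_0 has_sum_reindex[OF inj] size by (rule has_sum_gf[OF fin])
  also have "gf pair_size cyl = (\<Sum>n. q ^ (n * (n + 1)) * qpoch (- (q ^ 2)) (q ^ 2) n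
            / (qpoch (- (q ^ 3)) (q ^ 2) n * qpoch (q ^ 2) (q ^ 2) n))
       * (qpoch_inf (- (q ^ 3)) (q ^ 2) / qpoch_inf q q)"
    \<comment> \<open>The constant coefficient of \<open>qpoch_inf q q\<close> is 1, so dividing by
      it is multiplying by its inverse.\<close>
    using gf_cyl_eq[OF h_series_sums[where 'a = rat]]
    by (simp add: assms fps_divide_unit qpoch_X_tendsto(2) mult.assoc)
  finally show ?thesis .
qed

end
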